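(* For $k\ge1$ and $n\ge0$, $x_k[n]=\min(k,1+\mathrm{rank}_k(n))$.
   Context: For $k\ge1$, $\tau_k$ is the substitution on the alphabet $\{1,\ldots,k\}$ given by $\tau_k(k)=k1$ and $\tau_k(i)=i+1$ for $1\le i<k$, and $x_k=x_k[0]x_k[1]\cdots$ is the infinite fixed point of $\tau_k$ (starting with the letter $k$), positions indexed from $0$. The sequence $(A_{k,p})_{p\ge0}$ is defined by $A_{k,p}=p+1$ for $0\le p<k$ and $A_{k,p}=A_{k,p-1}+A_{k,p-k}$ for $p\ge k$. For $n\ge0$, $D_k(n)$ denotes the unique finite set $D\subset\mathbb{N}$ whose elements are pairwise at distance at least $k$ and such that $\sum_{p\in D}A_{k,p}=n$; $\mathrm{rank}_k(n)$ is the least element of $D_k(n)$, or $+\infty$ if $n=0$. *)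

theory Defs
  imports "HOL-Library.Stream" "HOL-Library.Extended_Nat"
begin

text \<open>
  The letters are the natural numbers \<open>1, \<dots>, k\<close>. The value of \<open>tau k\<close> outside of this
  alphabet is irrelevant.
\<close>

definition tau :: "nat \<Rightarrow> nat \<Rightarrow> nat list" where
  "tau k i = (if i = k then [k, 1] else [i + 1])"

text \<open>
  As all \<open>tau k i\<close> are nonempty, \<open>flat (smap (tau k) x)\<close> is the infinite word
  \<open>tau k x\<^sub>0 @ tau k x\<^sub>1 @ \<dots>\<close>, that is, the image of \<open>x\<close> under the substitution.
\<close>

definition xword :: "nat \<Rightarrow> nat stream" where
  "xword k = (THE x. x \<in> streams {1..k} \<and> shd x = k \<and> flat (smap (tau k) x) = x)"

text \<open>The disjunct \<open>k = 0\<close> only ensures termination; the parameter is meant to satisfy \<open>k \<ge> 1\<close>.\<close>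

fun A :: "nat \<Rightarrow> nat \<Rightarrow> nat" where
  "A k p = (if k = 0 \<or> p < k then p + 1 else A k (p - 1) + A k (p - k))"

declare A.simps [simp del]

definition separated :: "nat \<Rightarrow> nat set \<Rightarrow> bool" where
  "separated k D \<longleftrightarrow> (\<forall>p\<in>D. \<forall>q\<in>D. p < q \<longrightarrow> k \<le> q - p)"

definition decomp :: "nat \<Rightarrow> nat \<Rightarrow> nat set" where
  "decomp k n = (THE D. finite D \<and> separated k D \<and> (\<Sum>p\<in>D. A k p) = n)"

definition rank :: "nat \<Rightarrow> nat \<Rightarrow> enat" where
  "rank k n = (if n = 0 then \<infinity> else enat (Min (decomp k n)))"

end

theory Submission
  imports Defs
begin

text \<open>
  The iterates \<open>w\<^sub>p = \<tau>\<^sub>k\<^sup>p(k)\<close> are prefixes of \<open>x\<^sub>k\<close> of length \<open>A\<^bsub>k,p\<^esub>\<close> and satisfy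
  \<open>w\<^bsub>p+1\<^esub> = w\<^sub>p w\<^bsub>p+1-k\<^esub>\<close> for \<open>p + 1 \<ge> k\<close>. Hence if \<open>q\<close> is the largest element of \<open>D\<^sub>k(n)\<close>,
  so that \<open>A\<^bsub>k,q\<^esub> \<le> n < A\<^bsub>k,q+1\<^esub>\<close>, the letters of \<open>x\<^sub>k\<close> at \<open>n\<close> and \<open>n - A\<^bsub>k,q\<^esub>\<close> agree if \<open>q + 1 \<ge> k\<close>,
  and \<open>n = A\<^bsub>k,q\<^esub>\<close> otherwise. Removing the elements of \<open>D\<^sub>k(n)\<close> from the largest one downwards leaves
  only its least element \<open>r\<close>, and the letter of \<open>x\<^sub>k\<close> at \<open>A\<^bsub>k,r\<^esub>\<close> is \<open>min(k, r + 1)\<close>.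
\<close>

section \<open>Growth of the sequence \<open>A\<close>\<close>

lemma A_0: "A k 0 = 1"
  by (subst A.simps) auto

lemma A_eq_Suc: "p < k \<Longrightarrow> A k p = Suc p"
  by (subst A.simps) simp

text \<open>Writing both regimes of the recurrence as one increment matches
  \<open>word_Suc_append\<close>, where the increment is the length of the appended word.\<close>

lemma A_Suc:
  assumes "k \<ge> 1"
  shows "A k (Suc p) = A k p + (if Suc p < k then 1 else A k (Suc p - k))"
proof (cases "Suc p < k")
  case True
  then show ?thesis by (simp add: A_eq_Suc)
next
  case False
  then show ?thesis using assms by (subst A.simps) simp
qed

lemma A_pos:
  assumes "k \<ge> 1"
  shows "A k p > 0"
  using assms by (induction p) (auto simp: A_0 A_Suc)

lemma strict_mono_A:
  assumes "k \<ge> 1"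
  shows "strict_mono (A k)"
  using A_pos[OF assms] by (auto simp: strict_mono_Suc_iff A_Suc[OF assms])

lemma index_less_A:
  assumes "k \<ge> 1"
  shows "n < A k n"
proof (induction n)
  case (Suc n)
  then show ?case using A_pos[OF assms, of "Suc n - k"] by (simp add: A_Suc[OF assms])
qed (simp add: A_0)

lemma A_bracket:
  assumes "k \<ge> 1" "n > 0"
  obtains q where "A k q \<le> n" "n < A k (Suc q)"
proof -
  let ?p = "LEAST p. n < A k p"
  have p: "n < A k ?p"
    using index_less_A[OF assms(1)] by (rule LeastI)
  then have "?p \<noteq> 0"
    using assms by (metis A_0 less_one not_gr_zero)
  then obtain q where q: "?p = Suc q"
    using not0_implies_Suc by blast
  then have "\<not> n < A k q"
    by (metis lessI not_less_Least)
  then show ?thesis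
    using that[of q] p q by simp
qed

lemma A_bracket_unique:
  assumes "k \<ge> 1" "A k q \<le> n" "n < A k (Suc q)" "A k r \<le> n" "n < A k (Suc r)"
  shows "q = r"
  using assms strict_mono_less[OF strict_mono_A[OF assms(1)]]
  by (meson le_less_trans less_Suc_eq_le order_antisym)


subsection \<open>The decompositions\<close>

lemma separated_subset: "separated k D \<Longrightarrow> E \<subseteq> D \<Longrightarrow> separated k E"
  unfolding separated_def by blast

text \<open>The bound is the index occurring in \<open>A_Suc\<close>. Subtraction is truncated, so
  for \<open>Suc (Max D) < k\<close> nothing remains besides the maximum.\<close>

lemma separated_remove_Max:
  assumes "separated k D" "finite D" "k \<ge> 1"
  shows "D - {Max D} \<subseteq> {..<Suc (Max D) - k}"
proof
  fix r assume r: "r \<in> D - {Max D}"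
  then have "Max D \<in> D"
    using assms(2) by (intro Max_in) auto
  moreover have "r < Max D"
    using assms(2) r by (simp add: le_neq_implies_less)
  ultimately have "k \<le> Max D - r"
    using assms r unfolding separated_def by blast
  then show "r \<in> {..<Suc (Max D) - k}"
    using assms \<open>r < Max D\<close> by auto
qed

lemma sum_remove_Max:
  assumes "finite D" "D \<noteq> {}"
  shows "sum f D = f (Max D) + sum f (D - {Max D})"
  using assms by (intro sum.remove Max_in)

text \<open>Split off the maximum \<open>q\<close>: by induction the rest stays below the increment
  from \<open>A k q\<close> to \<open>A k (Suc q)\<close>.\<close>

lemma separated_sum_less:
  assumes "k \<ge> 1" "separated k D" "D \<subseteq> {..<p}"
  shows "sum (A k) D < A k p"
  using assms(2,3)
proof (induction p arbitrary: D rule: less_induct)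
  case (less p)
  show ?case
  proof (cases "D = {}")
    case True
    then show ?thesis using A_pos assms by simp
  next
    case False
    have fin: "finite D"
      using less.prems finite_subset by blast
    let ?q = "Max D"
    have "?q < p"
      using Max_in[OF fin False] less.prems by auto
    have sub: "D - {?q} \<subseteq> {..<Suc ?q - k}"
      using separated_remove_Max less.prems fin assms by blast
    have "sum (A k) (D - {?q}) < (if Suc ?q < k then 1 else A k (Suc ?q - k))"
    proof (cases "Suc ?q < k")
      case True
      then have "D - {?q} = {}" using sub by auto
      then show ?thesis using True by (simp only: sum.empty) simp
    next
      case False
      have "Suc ?q - k < p" using \<open>?q < p\<close> assms by simp
      then show ?thesis
        using less.IH[OF _ separated_subset[OF less.prems(1)] sub] False by auto
    qed
    then have "sum (A k) D < A k (Suc ?q)"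
      using sum_remove_Max[OF fin False, of "A k"] A_Suc[OF assms(1)] by simp
    also have "\<dots> \<le> A k p"
      using \<open>?q < p\<close> strict_mono_less_eq[OF strict_mono_A[OF assms(1)]] by simp
    finally show ?thesis .
  qed
qed

text \<open>Together with \<open>A_bracket_unique\<close>, this shows that the sum determines the
  maximum, which drives the uniqueness proof.\<close>

lemma sum_A_bracket_Max:
  assumes "k \<ge> 1" "finite D" "separated k D" "D \<noteq> {}"
  shows "A k (Max D) \<le> sum (A k) D" "sum (A k) D < A k (Suc (Max D))"
proof -
  show "A k (Max D) \<le> sum (A k) D"
    using sum_remove_Max[OF assms(2,4), of "A k"] by simp
  show "sum (A k) D < A k (Suc (Max D))"
    using assms by (intro separated_sum_less) (auto simp: less_Suc_eq_le)
qed

lemma sum_A_eq_0_iff: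
  assumes "k \<ge> 1" "finite D"
  shows "sum (A k) D = 0 \<longleftrightarrow> D = {}"
  using A_pos[OF assms(1)] assms(2) by (auto simp: less_imp_neq[symmetric])

lemma separated_sum_unique:
  assumes "k \<ge> 1" "finite D" "separated k D" "finite E" "separated k E"
    and "sum (A k) D = sum (A k) E"
  shows "D = E"
  using assms(2-)
proof (induction "card D" arbitrary: D E rule: less_induct)
  case less
  show ?case
  proof (cases "D = {}")
    case True
    then show ?thesis
      using less.prems sum_A_eq_0_iff[OF assms(1), of E] by simp
  next
    case False
    then have E: "E \<noteq> {}"
      using less.prems sum_A_eq_0_iff[OF assms(1), of D] by auto
    have eq: "Max D = Max E"
      using sum_A_bracket_Max[OF assms(1) less.prems(1,2) False]
        sum_A_bracket_Max[OF assms(1) less.prems(3,4) E]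
      unfolding less.prems(5) by (rule A_bracket_unique[OF assms(1)])
    have "sum (A k) (D - {Max D}) = sum (A k) (E - {Max E})"
      using sum_remove_Max[OF less.prems(1) False, of "A k"]
        sum_remove_Max[OF less.prems(3) E, of "A k"] less.prems(5) eq by simp
    moreover have "card (D - {Max D}) < card D"
      using less.prems False by (intro card_Diff1_less Max_in)
    moreover have "separated k (D - {Max D})" "separated k (E - {Max E})"
      using less.prems separated_subset by blast+
    ultimately have "D - {Max D} = E - {Max E}"
      using less.prems by (intro less.hyps) simp_all
    then show ?thesis
      using eq Max_in[OF less.prems(1) False] Max_in[OF less.prems(3) E]
      by (metis insert_Diff)
  qed
qed

text \<open>Greedy choice: take the largest \<open>A k q\<close> not exceeding \<open>n\<close> and
  decompose the remainder.\<close>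

lemma separated_sum_exists:
  assumes "k \<ge> 1"
  shows "\<exists>D. finite D \<and> separated k D \<and> sum (A k) D = n"
proof (induction n rule: less_induct)
  case (less n)
  show ?case
  proof (cases "n = 0")
    case True
    then show ?thesis by (intro exI[of _ "{}"]) (simp add: separated_def)
  next
    case False
    then obtain q where q: "A k q \<le> n" "n < A k (Suc q)"
      using A_bracket[OF assms, of n] by blast
    have "n - A k q < n"
      using q A_pos[OF assms, of q] by simp
    then obtain E where E: "finite E" "separated k E" "sum (A k) E = n - A k q"
      using less.IH by blast
    have far: "r + k \<le> q" if "r \<in> E" for r
    proof -
      have le: "A k r \<le> n - A k q"
        using member_le_sum[OF that, of "A k"] E by simp
      \<comment> \<open>Otherwise \<open>A k (Suc q)\<close> is \<open>A k q + 1\<close>, so the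
        remainder is 0 and cannot contain the positive summand \<open>A k r\<close>.\<close>
      have "\<not> Suc q < k"
        using le q A_Suc[OF assms, of q] A_pos[OF assms, of r] by auto
      moreover from this have "A k r < A k (Suc q - k)"
        using le q A_Suc[OF assms, of q] by simp
      ultimately show ?thesis
        using strict_mono_less[OF strict_mono_A[OF assms]] by simp
    qed
    have "q \<notin> E"
      using far[of q] assms by auto
    then have "sum (A k) (insert q E) = n"
      using E q by simp
    moreover have "separated k (insert q E)"
      unfolding separated_def
    proof (intro ballI impI)
      fix p r assume "p \<in> insert q E" "r \<in> insert q E" "p < r"
      then show "k \<le> r - p"
        using E(2) far[of p] far[of r] unfolding separated_def by (elim insertE) auto
    qed
    ultimately show ?thesis
      using E(1) by (intro exI[of _ "insert q E"]) simp
  qed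
qed

lemma decomp_properties:
  assumes "k \<ge> 1"
  shows "finite (decomp k n)" "separated k (decomp k n)" "sum (A k) (decomp k n) = n"
proof -
  have "\<exists>!D. finite D \<and> separated k D \<and> sum (A k) D = n"
    using separated_sum_exists[OF assms] separated_sum_unique[OF assms] by metis
  from theI'[OF this] show "finite (decomp k n)" "separated k (decomp k n)"
    "sum (A k) (decomp k n) = n"
    unfolding decomp_def by auto
qed


subsection \<open>The fixed point of the substitution\<close>

definition word :: "nat \<Rightarrow> nat \<Rightarrow> nat list" where
  "word k p = ((\<lambda>u. concat (map (tau k) u)) ^^ p) [k]"

lemma word_0: "word k 0 = [k]"
  by (simp add: word_def)

lemma word_Suc: "word k (Suc p) = concat (map (tau k) (word k p))"
  by (simp add: word_def)

text \<open>Applying the substitution to the identity for \<open>p\<close> yields the next one. The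
  appended letter grows by one until it equals \<open>k\<close>, which is \<open>word k 0\<close>;
  from then on the appended word is itself an iterate.\<close>

lemma word_Suc_append:
  assumes "k \<ge> 1"
  shows "word k (Suc p) = word k p @ (if Suc p < k then [Suc p] else word k (Suc p - k))"
proof (induction p)
  case 0
  then show ?case using assms by (auto simp: word_Suc word_0 tau_def)
next
  case (Suc p)
  have "word k (Suc (Suc p)) = word k (Suc p) @
      concat (map (tau k) (if Suc p < k then [Suc p] else word k (Suc p - k)))"
    using Suc.IH by (metis concat_append map_append word_Suc)
  moreover have "concat (map (tau k) (if Suc p < k then [Suc p] else word k (Suc p - k))) =
      (if Suc (Suc p) < k then [Suc (Suc p)] else word k (Suc (Suc p) - k))"
    by (auto simp: tau_def word_0 Suc_diff_le not_less word_Suc[symmetric]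
        simp flip: less_eq_Suc_le dest!: Suc_lessI)
  ultimately show ?case by simp
qed

lemma length_word:
  assumes "k \<ge> 1"
  shows "length (word k p) = A k p"
proof (induction p rule: less_induct)
  case (less p)
  then show ?case
    using assms by (cases p) (auto simp: word_0 A_0 word_Suc_append A_Suc)
qed

lemma set_word:
  assumes "k \<ge> 1"
  shows "set (word k p) \<subseteq> {1..k}"
proof (induction p rule: less_induct)
  case (less p)
  show ?case
  proof (cases p)
    case 0
    then show ?thesis using assms by (simp add: word_0)
  next
    case (Suc q)
    then have "Suc q - k < p" using assms by simp
    then show ?thesis
      using less[of q] less[of "Suc q - k"] Suc assms by (auto simp: word_Suc_append)
  qed
qed

text \<open>Earlier iterates are prefixes of later ones, so a letter can be read off in any iterate
  that is long enough.\<close>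

lemma nth_word_mono:
  assumes "k \<ge> 1" "p \<le> q" "n < A k p"
  shows "word k q ! n = word k p ! n"
  using assms(2)
proof (induction q rule: dec_induct)
  case (step q)
  have "n < A k q"
    using assms(3) strict_mono_less_eq[OF strict_mono_A[OF assms(1)], of p q] step.hyps
    by simp
  then show ?case
    using step.IH assms(1) by (simp add: word_Suc_append nth_append length_word)
qed simp

lemma stream_eqI: "(\<And>n. x !! n = y !! n) \<Longrightarrow> x = y"
  using smap_alt[of "\<lambda>a. a" x y] by (simp add: stream.map_ident)

lemma flat_smap_tau_shift:
  "flat (smap (tau k) (u @- x)) = concat (map (tau k) u) @- flat (smap (tau k) x)"
proof (induction u)
  case (Cons a u)
  \<comment> \<open>\<open>flat\<close> unfolds to a concatenation only when the first list is
    nonempty.\<close>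
  have "tau k a \<noteq> []" by (simp add: tau_def)
  then show ?case using Cons.IH by simp
qed simp

text \<open>An explicit solution gives existence and uniqueness at once, so the description in
  \<open>xword_def\<close> simplifies away. The diagonal is well defined because
  \<open>word k n\<close> has length \<open>A k n > n\<close>.\<close>

lemma flat_smap_tau_fixed_iff:
  assumes "k \<ge> 1"
  shows "x \<in> streams {1..k} \<and> shd x = k \<and> flat (smap (tau k) x) = x \<longleftrightarrow>
    x = smap (\<lambda>n. word k n ! n) nats" (is "?fixed x \<longleftrightarrow> x = ?w")
proof
  assume x: "?fixed x"
  \<comment> \<open>Every fixed point starting with \<open>k\<close> has all iterates as prefixes,
    hence is determined.\<close>
  have "\<exists>y. x = word k p @- y" for p
  proof (induction p)
    case 0
    then show ?case using x by (metis shift.simps stream.collapse word_0)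
  next
    case (Suc p)
    then show ?case using x flat_smap_tau_shift word_Suc by metis
  qed
  then have "x !! n = word k n ! n" for n
    using index_less_A[OF assms, of n] length_word[OF assms]
    by (metis shift_snth_less)
  then show "x = ?w"
    by (intro stream_eqI) simp
next
  have prefix: "\<exists>y. ?w = word k p @- y" for p
  proof -
    have "stake (A k p) ?w = word k p"
    proof (rule nth_equalityI)
      fix n assume "n < length (stake (A k p) ?w)"
      then have n: "n < A k p" by simp
      show "stake (A k p) ?w ! n = word k p ! n"
        using n nth_word_mono[OF assms _ n, of n]
          nth_word_mono[OF assms, of n p n] index_less_A[OF assms, of n]
        by (cases "n \<le> p") simp_all
    qed (simp add: length_word[OF assms])
    then show ?thesis by (metis stake_sdrop)
  qed
  \<comment> \<open>The prefix \<open>word k n\<close> is mapped to \<open>word k (Suc n)\<close>,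
    which has the same letter at \<open>n\<close>.\<close>
  have "flat (smap (tau k) ?w) !! n = ?w !! n" for n
  proof -
    obtain y where "?w = word k n @- y" using prefix by blast
    then obtain z where z: "flat (smap (tau k) ?w) = word k (Suc n) @- z"
      using flat_smap_tau_shift word_Suc by metis
    have "n < A k (Suc n)"
      using index_less_A[OF assms, of "Suc n"] by simp
    then show ?thesis
      using nth_word_mono[OF assms, of n "Suc n" n] index_less_A[OF assms, of n]
      by (simp add: z length_word[OF assms] shift_snth_less)
  qed
  then have "flat (smap (tau k) ?w) = ?w"
    by (rule stream_eqI)
  moreover have "word k n ! n \<in> {1..k}" for n
    using set_word[OF assms] index_less_A[OF assms] length_word[OF assms] nth_mem
    by (metis subsetD)
  then have "?w \<in> streams {1..k}"
    by (auto simp: streams_iff_snth)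
  ultimately show "?fixed x" if "x = ?w"
    using that by (simp add: word_0)
qed

section \<open>Letters of the fixed point at decomposed positions\<close>

lemma xword_snth:
  assumes "k \<ge> 1" "n < A k p"
  shows "xword k !! n = word k p ! n"
proof -
  have "xword k !! n = word k n ! n"
    unfolding xword_def flat_smap_tau_fixed_iff[OF assms(1)] by simp
  also have "\<dots> = word k p ! n"
    using nth_word_mono[OF assms(1), of n p n] nth_word_mono[OF assms(1), of p n n]
      index_less_A[OF assms(1), of n] assms(2) by (cases "n \<le> p") simp_all
  finally show ?thesis .
qed

lemma xword_0: "k \<ge> 1 \<Longrightarrow> xword k !! 0 = k"
  using xword_snth[of k 0 0] by (simp add: A_0 word_0)

text \<open>The position lies in the second factor of
  \<open>word k (Suc q) = word k q @ word k (Suc q - k)\<close>, and that factor is again a prefix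
  of \<open>xword k\<close>.\<close>

lemma xword_A_add:
  assumes "k \<ge> 1" "k \<le> Suc q" "m < A k (Suc q - k)"
  shows "xword k !! (A k q + m) = xword k !! m"
  using assms xword_snth[of k "A k q + m" "Suc q"] xword_snth[of k m "Suc q - k"]
  by (simp add: A_Suc word_Suc_append nth_append length_word)

text \<open>This is the letter just after the prefix \<open>word k q\<close>: either the single
  appended letter \<open>Suc q\<close>, or the first letter \<open>k\<close> of an appended
  iterate.\<close>

lemma xword_A:
  assumes "k \<ge> 1"
  shows "xword k !! A k q = min k (Suc q)"
proof (cases "Suc q < k")
  case True
  then show ?thesis
    using assms xword_snth[of k "A k q" "Suc q"]
    by (simp add: A_Suc word_Suc_append nth_append length_word)
next
  case False
  then show ?thesis
    using assms xword_A_add[of k q 0] A_pos[of k "Suc q - k"] xword_0[of k] by simp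
qed

lemma xword_sum_A:
  assumes "k \<ge> 1" "finite D" "separated k D" "D \<noteq> {}"
  shows "xword k !! sum (A k) D = min k (Suc (Min D))"
  using assms(2-)
proof (induction "card D" arbitrary: D rule: less_induct)
  case less
  let ?E = "D - {Max D}"
  note sum = sum_remove_Max[OF less.prems(1,3), of "A k"]
  have D: "insert (Max D) ?E = D"
    using less.prems by (simp add: insert_absorb)
  show ?case
  proof (cases "?E = {}")
    case True
    then have "Min D = Max D"
      using D by (metis Min_singleton)
    moreover have "sum (A k) D = A k (Max D)"
      using sum unfolding True by simp
    ultimately show ?thesis
      using xword_A[OF assms(1), of "Max D"] by simp
  next
    case False
    have sub: "?E \<subseteq> {..<Suc (Max D) - k}"
      using separated_remove_Max less.prems assms(1) by blast
    have sep: "separated k ?E"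
      using separated_subset less.prems by blast
    have "sum (A k) ?E < A k (Suc (Max D) - k)"
      using separated_sum_less[OF assms(1) sep sub] .
    \<comment> \<open>A nonempty \<open>?E\<close> forces the truncated difference in
      \<open>sub\<close> to be positive.\<close>
    moreover have "k \<le> Suc (Max D)"
      using sub False by auto
    ultimately have "xword k !! sum (A k) D = xword k !! sum (A k) ?E"
      unfolding sum by (rule xword_A_add[OF assms(1), rotated])
    also have "\<dots> = min k (Suc (Min ?E))"
    proof (rule less.hyps)
      show "card ?E < card D"
        using less.prems by (intro card_Diff1_less Max_in)
    qed (use less.prems sep False in simp_all)
    also have "Min ?E = Min D"
    proof -
      have "Min ?E \<le> Max D"
        using less.prems False by (meson Diff_subset Max_ge Min_in finite_Diff subsetD)
      moreover have "Min D = min (Max D) (Min ?E)"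
        using Min_insert[of ?E "Max D"] less.prems(1) False unfolding D by simp
      ultimately show ?thesis by simp
    qed
    finally show ?thesis .
  qed
qed

theorem theorem5p2:
  fixes k n :: nat
  assumes "k \<ge> 1"
  shows "enat (xword k !! n) = min (enat k) (1 + rank k n)"
proof (cases "n = 0")
  case True
  \<comment> \<open>Here the rank is infinite, so the minimum is \<open>k\<close>, the first
    letter.\<close>
  then show ?thesis using xword_0[OF assms] by (simp add: rank_def)
next
  case False
  note decomp = decomp_properties[OF assms, of n]
  have "decomp k n \<noteq> {}"
    using decomp(3) False by force
  then have "xword k !! n = min k (Suc (Min (decomp k n)))"
    using xword_sum_A[OF assms decomp(1,2)] decomp(3) by simp
  then show ?thesis
    using False by (simp add: rank_def one_enat_def)
qed

end
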